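(* Let $\mathsf{CS}$ be an axiomatically appropriate constant specification for $\mathsf{JE}$. For every formula $F$: $\mathsf{JE}_{\mathsf{CS}}\vdash F$ if and only if $\mathcal M\Vdash F$ for every fully explanatory $\mathsf{JE}_{\mathsf{CS}}$ modular model $\mathcal M$.
   Context: Language. Fix countably many proof constants $\alpha_i$, proof variables $\xi_i$, and a countable set $\mathsf{Prop}$ of atomic propositions. Proof terms: $\lambda ::= \alpha_i \mid \xi_i \mid (\lambda\cdot\lambda) \mid (\lambda+\lambda) \mid\ !\lambda$ (set $\mathsf{PTm}$). Justification terms: $t ::= \mathsf{e}(\lambda)$, $\lambda\in\mathsf{PTm}$ (set $\mathsf{JTm}$). Formulas: $F ::= P \mid \bot \mid (F\to F) \mid \lambda:F \mid [t]F$ (set $\mathsf{Fm}$); $\neg,\wedge,\vee,\leftrightarrow$ are classical abbreviations. Axioms of $\mathsf{JE}$: all instances of classical propositional tautologies, and all instances of (j) $\lambda:(F\to G)\to(\kappa:F\to\lambda\cdot\kappa:G)$; (j+$_1$) $(\lambda:F\vee\kappa:F)\to(\lambda+\kappa):F$; (jt) $\lambda:F\to F$; (j4) $\lambda:F\to\ !\lambda:\lambda:F$; (je) $(\lambda:(F\to G)\wedge\lambda:(G\to F))\to([\mathsf{e}(\lambda)]F\to[\mathsf{e}(\lambda)]G)$; (je+) $([\mathsf{e}(\lambda)]F\vee[\mathsf{e}(\kappa)]F)\to[\mathsf{e}(\lambda+\kappa)]F$. A constant specification $\mathsf{CS}$ is a set of pairs $(\alpha,A)$, $\alpha$ a proof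 constant, $A$ an axiom of $\mathsf{JE}$; it is axiomatically appropriate if for every axiom $A$ of $\mathsf{JE}$ there is a proof constant $\alpha$ with $(\alpha,A)\in\mathsf{CS}$. $\mathsf{JE}_{\mathsf{CS}}$ is the Hilbert system with the axioms of $\mathsf{JE}$, modus ponens, and axiom necessitation (infer $\alpha:A$ whenever $(\alpha,A)\in\mathsf{CS}$). Basic evaluations. For sets of formulas $X,Y$: $\lambda:X=\{\lambda:F\mid F\in X\}$; $X\cdot Y=\{F\mid G\to F\in X\text{ for some }G\in Y\}$; $X\odot Y=\{F\mid F\to G\in X\text{ and }G\to F\in X\text{ for some }G\in Y\}$. A basic evaluation is a map $\varepsilon$ with $\varepsilon(P)\in\{0,1\}$ for $P\in\mathsf{Prop}$ and $\varepsilon:\mathsf{PTm}\cup\mathsf{JTm}\to\mathcal P(\mathsf{Fm})$ such that for all $\lambda,\kappa\in\mathsf{PTm}$: $\varepsilon(\lambda)\cdot\varepsilon(\kappa)\subseteq\varepsilon(\lambda\cdot\kappa)$; $\varepsilon(\lambda)\cup\varepsilon(\kappa)\subseteq\varepsilon(\lambda+\kappa)$; $F\in\varepsilon(\lambda)$ if $(\lambda,F)\in\mathsf{CS}$; $\lambda:\varepsilon(\lambda)\subseteq\varepsilon(!\lambda)$; $\varepsilon(\lambda)\odot\varepsilon(\mathsf{e}(\lambda))\subseteq\varepsilon(\mathsf{e}(\lambda))$; $\varepsilon(\mathsf{e}(\lambda))\cup\varepsilon(\mathsf{e}(\kappa))\subseteq\varepsilon(\mathsf{e}(\lambda+\kappa))$.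 Modular models. A quasi-model is $\mathcal M=\langle W,N,\varepsilon\rangle$ with $W\neq\emptyset$, $N:W\to\mathcal P(\mathcal P(W))$, and $\varepsilon$ assigning to each $w$ a basic evaluation $\varepsilon_w$. Truth: $\mathcal M,w\nVdash\bot$; $\mathcal M,w\Vdash P$ iff $\varepsilon_w(P)=1$; $\to$ classical; $\mathcal M,w\Vdash\lambda:F$ iff $F\in\varepsilon_w(\lambda)$; $\mathcal M,w\Vdash[t]F$ iff $F\in\varepsilon_w(t)$. $\mathcal M\Vdash F$ means truth at all worlds; $|F|^{\mathcal M}=\{w\mid\mathcal M,w\Vdash F\}$. A $\mathsf{JE}_{\mathsf{CS}}$ modular model is a quasi-model that is factive ($\mathcal M,w\Vdash\lambda:F$ implies $\mathcal M,w\Vdash F$) and satisfies: for all $t\in\mathsf{JTm}$, $w\in W$, $F$, if $F\in\varepsilon_w(t)$ then $|F|^{\mathcal M}\in N(w)$. It is fully explanatory if for all $w\in W$ and formulas $F$, $|F|^{\mathcal M}\in N(w)$ implies $F\in\varepsilon_w(t)$ for some $t\in\mathsf{JTm}$. *)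

theory Defs
  imports Main "HOL-Library.Countable"
begin

datatype ptm =
    PConst nat
  | PVar nat
  | PApp ptm ptm  (infixl \<open>\<^bold>\<cdot>\<close> 70)
  | PSum ptm ptm  (infixl \<open>\<^bold>+\<close> 65)
  | PBang ptm     (\<open>\<^bold>! _\<close> [90] 90)

datatype jtm = JE ptm

datatype 'p fm =
    Atom 'p
  | Bot                    (\<open>\<^bold>\<bottom>\<close>)
  | Imp "'p fm" "'p fm"    (infixr \<open>\<^bold>\<rightarrow>\<close> 55)
  | Prf ptm "'p fm"        (infixr \<open>\<^bold>:\<close> 61)
  | Box jtm "'p fm"        (\<open>\<^bold>[_\<^bold>] _\<close> [0, 61] 61)

abbreviation Neg :: "'p fm \<Rightarrow> 'p fm"  (\<open>\<^bold>\<not> _\<close> [61] 61) where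
  "\<^bold>\<not> F \<equiv> F \<^bold>\<rightarrow> \<^bold>\<bottom>"

abbreviation Or :: "'p fm \<Rightarrow> 'p fm \<Rightarrow> 'p fm"  (infixr \<open>\<^bold>\<or>\<close> 57) where
  "F \<^bold>\<or> G \<equiv> \<^bold>\<not> F \<^bold>\<rightarrow> G"

abbreviation And :: "'p fm \<Rightarrow> 'p fm \<Rightarrow> 'p fm"  (infixr \<open>\<^bold>\<and>\<close> 59) where
  "F \<^bold>\<and> G \<equiv> \<^bold>\<not> (F \<^bold>\<rightarrow> \<^bold>\<not> G)"

datatype pform = PrVar nat | PrBot | PrImp pform pform

primrec pr_eval :: "(nat \<Rightarrow> bool) \<Rightarrow> pform \<Rightarrow> bool" where
  "pr_eval v (PrVar n) = v n"
| "pr_eval v PrBot = False"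
| "pr_eval v (PrImp p q) = (pr_eval v p \<longrightarrow> pr_eval v q)"

definition tautology :: "pform \<Rightarrow> bool" where
  "tautology p \<longleftrightarrow> (\<forall>v. pr_eval v p)"

primrec pr_subst :: "(nat \<Rightarrow> 'p fm) \<Rightarrow> pform \<Rightarrow> 'p fm" where
  "pr_subst \<sigma> (PrVar n) = \<sigma> n"
| "pr_subst \<sigma> PrBot = \<^bold>\<bottom>"
| "pr_subst \<sigma> (PrImp p q) = pr_subst \<sigma> p \<^bold>\<rightarrow> pr_subst \<sigma> q"

inductive JE_axiom :: "'p fm \<Rightarrow> bool" where
  taut: "tautology p \<Longrightarrow> JE_axiom (pr_subst \<sigma> p)"
| j: "JE_axiom (l \<^bold>: (F \<^bold>\<rightarrow> G) \<^bold>\<rightarrow> (k \<^bold>: F \<^bold>\<rightarrow> (l \<^bold>\<cdot> k) \<^bold>: G))"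
| jplus: "JE_axiom ((l \<^bold>: F \<^bold>\<or> k \<^bold>: F) \<^bold>\<rightarrow> (l \<^bold>+ k) \<^bold>: F)"
| jt: "JE_axiom (l \<^bold>: F \<^bold>\<rightarrow> F)"
| j4: "JE_axiom (l \<^bold>: F \<^bold>\<rightarrow> (\<^bold>! l) \<^bold>: l \<^bold>: F)"
| je: "JE_axiom ((l \<^bold>: (F \<^bold>\<rightarrow> G) \<^bold>\<and> l \<^bold>: (G \<^bold>\<rightarrow> F)) \<^bold>\<rightarrow> (\<^bold>[JE l\<^bold>] F \<^bold>\<rightarrow> \<^bold>[JE l\<^bold>] G))"
| jeplus: "JE_axiom ((\<^bold>[JE l\<^bold>] F \<^bold>\<or> \<^bold>[JE k\<^bold>] F) \<^bold>\<rightarrow> \<^bold>[JE (l \<^bold>+ k)\<^bold>] F)"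

type_synonym 'p const_spec = "(ptm \<times> 'p fm) set"

definition constant_specification :: "'p const_spec \<Rightarrow> bool" where
  "constant_specification CS \<longleftrightarrow> CS \<subseteq> range PConst \<times> {A. JE_axiom A}"

definition axiomatically_appropriate :: "'p const_spec \<Rightarrow> bool" where
  "axiomatically_appropriate CS \<longleftrightarrow> (\<forall>A. JE_axiom A \<longrightarrow> (\<exists>i. (PConst i, A) \<in> CS))"

inductive JE_derivable :: "'p const_spec \<Rightarrow> 'p fm \<Rightarrow> bool"  (infix \<open>\<turnstile>\<^sub>J\<^sub>E\<close> 50)
  for CS :: "'p const_spec" where
  ax: "JE_axiom A \<Longrightarrow> CS \<turnstile>\<^sub>J\<^sub>E A"
| mp: "CS \<turnstile>\<^sub>J\<^sub>E F \<^bold>\<rightarrow> G \<Longrightarrow> CS \<turnstile>\<^sub>J\<^sub>E F \<Longrightarrow> CS \<turnstile>\<^sub>J\<^sub>E G"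
| an: "(c, A) \<in> CS \<Longrightarrow> CS \<turnstile>\<^sub>J\<^sub>E c \<^bold>: A"

definition set_app :: "'p fm set \<Rightarrow> 'p fm set \<Rightarrow> 'p fm set" where
  "set_app X Y = {F. \<exists>G\<in>Y. G \<^bold>\<rightarrow> F \<in> X}"

definition set_equiv :: "'p fm set \<Rightarrow> 'p fm set \<Rightarrow> 'p fm set" where
  "set_equiv X Y = {F. \<exists>G\<in>Y. F \<^bold>\<rightarrow> G \<in> X \<and> G \<^bold>\<rightarrow> F \<in> X}"

record 'p evaluation =
  val :: "'p \<Rightarrow> bool"
  pev :: "ptm \<Rightarrow> 'p fm set"
  jev :: "jtm \<Rightarrow> 'p fm set"

definition basic_evaluation :: "'p const_spec \<Rightarrow> 'p evaluation \<Rightarrow> bool" where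
  "basic_evaluation CS \<epsilon> \<longleftrightarrow>
     (\<forall>l k. set_app (pev \<epsilon> l) (pev \<epsilon> k) \<subseteq> pev \<epsilon> (l \<^bold>\<cdot> k)) \<and>
     (\<forall>l k. pev \<epsilon> l \<union> pev \<epsilon> k \<subseteq> pev \<epsilon> (l \<^bold>+ k)) \<and>
     (\<forall>l F. (l, F) \<in> CS \<longrightarrow> F \<in> pev \<epsilon> l) \<and>
     (\<forall>l. Prf l ` pev \<epsilon> l \<subseteq> pev \<epsilon> (\<^bold>! l)) \<and>
     (\<forall>l. set_equiv (pev \<epsilon> l) (jev \<epsilon> (JE l)) \<subseteq> jev \<epsilon> (JE l)) \<and>
     (\<forall>l k. jev \<epsilon> (JE l) \<union> jev \<epsilon> (JE k) \<subseteq> jev \<epsilon> (JE (l \<^bold>+ k)))"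

record ('p, 'w) model =
  worlds :: "'w set"
  nbhd :: "'w \<Rightarrow> 'w set set"
  eval_at :: "'w \<Rightarrow> 'p evaluation"

definition quasi_model :: "'p const_spec \<Rightarrow> ('p, 'w) model \<Rightarrow> bool" where
  "quasi_model CS M \<longleftrightarrow>
     worlds M \<noteq> {} \<and>
     (\<forall>w\<in>worlds M. nbhd M w \<subseteq> Pow (worlds M)) \<and>
     (\<forall>w\<in>worlds M. basic_evaluation CS (eval_at M w))"

primrec holds :: "('p, 'w) model \<Rightarrow> 'w \<Rightarrow> 'p fm \<Rightarrow> bool" where
  "holds M w (Atom P) = val (eval_at M w) P"
| "holds M w \<^bold>\<bottom> = False"
| "holds M w (F \<^bold>\<rightarrow> G) = (holds M w F \<longrightarrow> holds M w G)"
| "holds M w (l \<^bold>: F) = (F \<in> pev (eval_at M w) l)"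
| "holds M w (\<^bold>[t\<^bold>] F) = (F \<in> jev (eval_at M w) t)"

definition truth_set :: "('p, 'w) model \<Rightarrow> 'p fm \<Rightarrow> 'w set" where
  "truth_set M F = {w \<in> worlds M. holds M w F}"

definition valid_in :: "('p, 'w) model \<Rightarrow> 'p fm \<Rightarrow> bool"  (infix \<open>\<TTurnstile>\<close> 50) where
  "M \<TTurnstile> F \<longleftrightarrow> (\<forall>w\<in>worlds M. holds M w F)"

definition factive :: "('p, 'w) model \<Rightarrow> bool" where
  "factive M \<longleftrightarrow> (\<forall>w\<in>worlds M. \<forall>l F. holds M w (l \<^bold>: F) \<longrightarrow> holds M w F)"

definition modular_model :: "'p const_spec \<Rightarrow> ('p, 'w) model \<Rightarrow> bool" where
  "modular_model CS M \<longleftrightarrow>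
     quasi_model CS M \<and> factive M \<and>
     (\<forall>t. \<forall>w\<in>worlds M. \<forall>F. F \<in> jev (eval_at M w) t \<longrightarrow> truth_set M F \<in> nbhd M w)"

definition fully_explanatory :: "('p, 'w) model \<Rightarrow> bool" where
  "fully_explanatory M \<longleftrightarrow>
     (\<forall>w\<in>worlds M. \<forall>F. truth_set M F \<in> nbhd M w \<longrightarrow> (\<exists>t. F \<in> jev (eval_at M w) t))"

text \<open>A HOL formula cannot quantify over world types. Hence soundness is asserted for an arbitrary
  world type \<open>'w\<close>, whereas the converse only assumes validity in those models whose worlds are
  sets of formulas, a weaker premise than validity in every model.\<close>

end

(* The canonical model has as worlds the sets of formulas that contain all theorems and respect
   falsum and implication, with the neighbourhoods of w being the truth sets of those G for which
   some [t]G lies in w.  It is fully explanatory: if F and G have the same truth set, then both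
   F -> G and G -> F are theorems by the Lindenbaum lemma, so by internalization a single proof
   term r justifies both of them.  From [e(l)]G in w, (je+) yields [e(l + r)]G, and (je) turns
   this into [e(l + r)]F. *)

theory Submission imports Defs begin

section \<open>Soundness\<close>

lemma holds_pr_subst:
  "holds M w (pr_subst \<sigma> p) \<longleftrightarrow> pr_eval (\<lambda>n. holds M w (\<sigma> n)) p"
  by (induction p) auto

lemma basic_evaluationD:
  assumes "basic_evaluation CS \<epsilon>"
  shows "G \<^bold>\<rightarrow> F \<in> pev \<epsilon> l \<Longrightarrow> G \<in> pev \<epsilon> k \<Longrightarrow> F \<in> pev \<epsilon> (l \<^bold>\<cdot> k)"
    and "F \<in> pev \<epsilon> l \<or> F \<in> pev \<epsilon> k \<Longrightarrow> F \<in> pev \<epsilon> (l \<^bold>+ k)"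
    and "(l, F) \<in> CS \<Longrightarrow> F \<in> pev \<epsilon> l"
    and "F \<in> pev \<epsilon> l \<Longrightarrow> l \<^bold>: F \<in> pev \<epsilon> (\<^bold>! l)"
    and "F \<^bold>\<rightarrow> G \<in> pev \<epsilon> l \<Longrightarrow> G \<^bold>\<rightarrow> F \<in> pev \<epsilon> l \<Longrightarrow> F \<in> jev \<epsilon> (JE l) \<Longrightarrow> G \<in> jev \<epsilon> (JE l)"
    and "F \<in> jev \<epsilon> (JE l) \<or> F \<in> jev \<epsilon> (JE k) \<Longrightarrow> F \<in> jev \<epsilon> (JE (l \<^bold>+ k))"
proof -
  have app: "set_app (pev \<epsilon> l) (pev \<epsilon> k) \<subseteq> pev \<epsilon> (l \<^bold>\<cdot> k)"
    and sum: "pev \<epsilon> l \<union> pev \<epsilon> k \<subseteq> pev \<epsilon> (l \<^bold>+ k)"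
    and cs: "(l, F) \<in> CS \<longrightarrow> F \<in> pev \<epsilon> l"
    and bang: "Prf l ` pev \<epsilon> l \<subseteq> pev \<epsilon> (\<^bold>! l)"
    and equiv: "set_equiv (pev \<epsilon> l) (jev \<epsilon> (JE l)) \<subseteq> jev \<epsilon> (JE l)"
    and esum: "jev \<epsilon> (JE l) \<union> jev \<epsilon> (JE k) \<subseteq> jev \<epsilon> (JE (l \<^bold>+ k))"
    using assms by (simp_all add: basic_evaluation_def)
  show "G \<^bold>\<rightarrow> F \<in> pev \<epsilon> l \<Longrightarrow> G \<in> pev \<epsilon> k \<Longrightarrow> F \<in> pev \<epsilon> (l \<^bold>\<cdot> k)"
    using app by (auto simp: set_app_def)
  show "F \<in> pev \<epsilon> l \<or> F \<in> pev \<epsilon> k \<Longrightarrow> F \<in> pev \<epsilon> (l \<^bold>+ k)"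
    using sum by auto
  show "(l, F) \<in> CS \<Longrightarrow> F \<in> pev \<epsilon> l"
    using cs by simp
  show "F \<in> pev \<epsilon> l \<Longrightarrow> l \<^bold>: F \<in> pev \<epsilon> (\<^bold>! l)"
    using bang by auto
  show "F \<^bold>\<rightarrow> G \<in> pev \<epsilon> l \<Longrightarrow> G \<^bold>\<rightarrow> F \<in> pev \<epsilon> l \<Longrightarrow> F \<in> jev \<epsilon> (JE l) \<Longrightarrow> G \<in> jev \<epsilon> (JE l)"
    using equiv by (auto simp: set_equiv_def)
  show "F \<in> jev \<epsilon> (JE l) \<or> F \<in> jev \<epsilon> (JE k) \<Longrightarrow> F \<in> jev \<epsilon> (JE (l \<^bold>+ k))"
    using esum by auto
qed

text \<open>Read elementwise, the closure conditions of a basic evaluation are the axioms (j), (j+),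
  (j4), (je) and (je+), while \<open>fact\<close> is (jt). All of this concerns one world at a
  time.\<close>

lemma JE_axiom_sound:
  assumes "JE_axiom A" and be: "basic_evaluation CS (eval_at M w)"
    and fact: "\<And>l F. holds M w (l \<^bold>: F) \<Longrightarrow> holds M w F"
  shows "holds M w A"
  using assms(1)
proof cases
  case (taut p \<sigma>)
  then show ?thesis by (simp add: holds_pr_subst tautology_def)
next
  case (j l F G k)
  then show ?thesis using basic_evaluationD(1)[OF be, of F G l k] by simp
next
  case (jplus l F k)
  then show ?thesis using basic_evaluationD(2)[OF be, of F l k] by auto
next
  case (jt l F)
  then show ?thesis using fact[of l F] by simp
next
  case (j4 l F)
  then show ?thesis using basic_evaluationD(4)[OF be, of F l] by simp
next
  case (je l F G)
  then show ?thesis using basic_evaluationD(5)[OF be, of F G l] by simp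
next
  case (jeplus l F k)
  then show ?thesis using basic_evaluationD(6)[OF be, of F l k] by auto
qed

lemma JE_sound:
  assumes "CS \<turnstile>\<^sub>J\<^sub>E F" and "modular_model CS M"
  shows "M \<TTurnstile> F"
proof -
  have "holds M w F" if w: "w \<in> worlds M" for w
  proof -
    have be: "basic_evaluation CS (eval_at M w)"
      and fact: "\<And>l F. holds M w (l \<^bold>: F) \<Longrightarrow> holds M w F"
      using assms(2) w unfolding modular_model_def quasi_model_def factive_def by blast+
    show ?thesis
      using assms(1)
    proof induction
      case (ax A)
      then show ?case by (rule JE_axiom_sound[OF _ be fact])
    next
      case (an c A)
      then show ?case using basic_evaluationD(3)[OF be] by simp
    qed simp
  qed
  then show ?thesis by (simp add: valid_in_def)
qed

section \<open>Propositional theorems and internalization\<close>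

lemma derivable_K: "CS \<turnstile>\<^sub>J\<^sub>E F \<^bold>\<rightarrow> (G \<^bold>\<rightarrow> F)"
proof -
  have "JE_axiom (pr_subst (\<lambda>n. if n = 0 then F else G)
      (PrImp (PrVar 0) (PrImp (PrVar 1) (PrVar 0))))"
    by (rule JE_axiom.taut) (simp add: tautology_def)
  then show ?thesis by (auto intro: JE_derivable.ax)
qed

lemma derivable_S: "CS \<turnstile>\<^sub>J\<^sub>E (F \<^bold>\<rightarrow> (G \<^bold>\<rightarrow> H)) \<^bold>\<rightarrow> ((F \<^bold>\<rightarrow> G) \<^bold>\<rightarrow> (F \<^bold>\<rightarrow> H))"
proof -
  have "JE_axiom (pr_subst (\<lambda>n. if n = 0 then F else if n = 1 then G else H)
      (PrImp (PrImp (PrVar 0) (PrImp (PrVar 1) (PrVar 2)))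
        (PrImp (PrImp (PrVar 0) (PrVar 1)) (PrImp (PrVar 0) (PrVar 2)))))"
    by (rule JE_axiom.taut) (simp add: tautology_def)
  then show ?thesis by (auto intro: JE_derivable.ax)
qed

lemma derivable_refl: "CS \<turnstile>\<^sub>J\<^sub>E F \<^bold>\<rightarrow> F"
  by (rule JE_derivable.mp[OF JE_derivable.mp[OF derivable_S derivable_K] derivable_K[of _ _ F]])

lemma derivable_ex_falso: "CS \<turnstile>\<^sub>J\<^sub>E \<^bold>\<bottom> \<^bold>\<rightarrow> F"
proof -
  have "JE_axiom (pr_subst (\<lambda>n. F) (PrImp PrBot (PrVar 0)))"
    by (rule JE_axiom.taut) (simp add: tautology_def)
  then show ?thesis by (auto intro: JE_derivable.ax)
qed

text \<open>If G fails, then G -> H holds for any H. This form of case distinction shows that a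
  theory maximal among those omitting F cannot omit both G and G -> H.\<close>

lemma derivable_cases:
  "CS \<turnstile>\<^sub>J\<^sub>E (G \<^bold>\<rightarrow> F) \<^bold>\<rightarrow> (((G \<^bold>\<rightarrow> H) \<^bold>\<rightarrow> F) \<^bold>\<rightarrow> F)"
proof -
  have "JE_axiom (pr_subst (\<lambda>n. if n = 0 then F else if n = 1 then G else H)
      (PrImp (PrImp (PrVar 1) (PrVar 0))
        (PrImp (PrImp (PrImp (PrVar 1) (PrVar 2)) (PrVar 0)) (PrVar 0))))"
    by (rule JE_axiom.taut) (auto simp: tautology_def)
  then show ?thesis by (auto intro: JE_derivable.ax)
qed

text \<open>A proof term is built along the derivation: appropriateness supplies a constant for each
  axiom, (j) turns modus ponens into application, and (j4) puts a bang on the term of axiom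
  necessitation.\<close>

lemma internalization:
  assumes "axiomatically_appropriate CS" and "CS \<turnstile>\<^sub>J\<^sub>E F"
  shows "\<exists>l. CS \<turnstile>\<^sub>J\<^sub>E l \<^bold>: F"
  using assms(2)
proof induction
  case (ax A)
  then show ?case
    using assms(1) unfolding axiomatically_appropriate_def by (meson JE_derivable.an)
next
  case (mp F G)
  then show ?case by (meson JE_axiom.j JE_derivable.ax JE_derivable.mp)
next
  case (an c A)
  then show ?case by (meson JE_axiom.j4 JE_derivable.ax JE_derivable.mp JE_derivable.an)
qed

section \<open>Theories and the Lindenbaum lemma\<close>

definition is_theory :: "'p const_spec \<Rightarrow> 'p fm set \<Rightarrow> bool" where
  "is_theory CS T \<longleftrightarrow> {F. CS \<turnstile>\<^sub>J\<^sub>E F} \<subseteq> T \<and> (\<forall>F G. F \<^bold>\<rightarrow> G \<in> T \<longrightarrow> F \<in> T \<longrightarrow> G \<in> T)"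

text \<open>These are exactly the maximal consistent sets: taking \<bottom> for G yields exactly one
  of F and its negation. The condition on implication has the shape that the truth lemma
  consumes.\<close>

definition maximal_theory :: "'p const_spec \<Rightarrow> 'p fm set \<Rightarrow> bool" where
  "maximal_theory CS w \<longleftrightarrow> {F. CS \<turnstile>\<^sub>J\<^sub>E F} \<subseteq> w \<and> \<^bold>\<bottom> \<notin> w \<and>
     (\<forall>F G. F \<^bold>\<rightarrow> G \<in> w \<longleftrightarrow> (F \<in> w \<longrightarrow> G \<in> w))"

lemma is_theory_derivable: "is_theory CS T \<Longrightarrow> CS \<turnstile>\<^sub>J\<^sub>E F \<Longrightarrow> F \<in> T"
  by (auto simp: is_theory_def)

lemma is_theory_mp: "is_theory CS T \<Longrightarrow> F \<^bold>\<rightarrow> G \<in> T \<Longrightarrow> F \<in> T \<Longrightarrow> G \<in> T"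
  by (auto simp: is_theory_def)

lemma is_theory_derivable_mp: "is_theory CS T \<Longrightarrow> CS \<turnstile>\<^sub>J\<^sub>E F \<^bold>\<rightarrow> G \<Longrightarrow> F \<in> T \<Longrightarrow> G \<in> T"
  using is_theory_derivable is_theory_mp by blast

text \<open>The two premises of a modus ponens may come from different members of the chain, but the
  larger member contains both. Nonemptiness puts the theorems into the union.\<close>

lemma is_theory_Union_chain:
  assumes "C \<noteq> {}" and "subset.chain {T. is_theory CS T \<and> F \<notin> T} C"
  shows "is_theory CS (\<Union>C) \<and> F \<notin> \<Union>C"
proof -
  have *: "is_theory CS T" "F \<notin> T" if "T \<in> C" for T
    using assms(2) that by (auto simp: subset_chain_def)
  have "H \<in> \<Union>C" if GH: "G \<^bold>\<rightarrow> H \<in> \<Union>C" "G \<in> \<Union>C" for G H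
  proof -
    obtain S T where "S \<in> C" "T \<in> C" "G \<^bold>\<rightarrow> H \<in> S" "G \<in> T" using GH by blast
    moreover from this have "S \<subseteq> T \<or> T \<subseteq> S"
      using assms(2) by (auto simp: subset_chain_def)
    ultimately show ?thesis using *(1) is_theory_mp by blast
  qed
  moreover have "{F. CS \<turnstile>\<^sub>J\<^sub>E F} \<subseteq> \<Union>C"
    using assms(1) *(1) is_theory_derivable by blast
  ultimately show ?thesis using *(2) by (auto simp: is_theory_def)
qed

text \<open>By the deduction theorem, \<open>{H. G \<^bold>\<rightarrow> H \<in> T}\<close> is the theory generated by \<open>T\<close> and \<open>G\<close>.\<close>

lemma is_theory_conditional:
  assumes "is_theory CS T"
  shows "is_theory CS {H. G \<^bold>\<rightarrow> H \<in> T}" and "T \<subseteq> {H. G \<^bold>\<rightarrow> H \<in> T}" and "G \<^bold>\<rightarrow> G \<in> T"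
proof -
  show sub: "T \<subseteq> {H. G \<^bold>\<rightarrow> H \<in> T}"
    using is_theory_derivable_mp[OF assms derivable_K] by blast
  show "G \<^bold>\<rightarrow> G \<in> T" by (rule is_theory_derivable[OF assms derivable_refl])
  \<comment> \<open>Modus ponens under the hypothesis G is the propositional axiom S.\<close>
  have "G \<^bold>\<rightarrow> K \<in> T" if "G \<^bold>\<rightarrow> (H \<^bold>\<rightarrow> K) \<in> T" "G \<^bold>\<rightarrow> H \<in> T" for H K
    using is_theory_mp[OF assms is_theory_derivable_mp[OF assms derivable_S]] that by blast
  then show "is_theory CS {H. G \<^bold>\<rightarrow> H \<in> T}"
    using sub is_theory_derivable[OF assms] by (auto simp: is_theory_def)
qed

text \<open>Zorn's lemma is applied to the theories that omit F, starting from the set of all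
  theorems. Maximality relative to F already forces full maximality, because every G outside the
  maximal \<open>w\<close> satisfies G -> F in \<open>w\<close>.\<close>

lemma lindenbaum:
  assumes "\<not> CS \<turnstile>\<^sub>J\<^sub>E F"
  shows "\<exists>w. maximal_theory CS w \<and> F \<notin> w"
proof -
  let ?A = "{T. is_theory CS T \<and> F \<notin> T}"
  have "{G. CS \<turnstile>\<^sub>J\<^sub>E G} \<in> ?A"
    using assms by (auto simp: is_theory_def intro: JE_derivable.mp)
  then have "?A \<noteq> {}" by blast
  then obtain w where w: "w \<in> ?A" and max: "\<And>X. X \<in> ?A \<Longrightarrow> w \<subseteq> X \<Longrightarrow> X = w"
    using subset_Zorn_nonempty[of ?A] is_theory_Union_chain[of _ CS F] by (metis (lifting) mem_Collect_eq)
  then have th: "is_theory CS w" and F: "F \<notin> w" by auto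
  \<comment> \<open>Otherwise the theory generated by \<open>w\<close> and G would still omit F,
    hence equal \<open>w\<close> by maximality, although it contains G.\<close>
  have imp: "G \<^bold>\<rightarrow> F \<in> w" if "G \<notin> w" for G
  proof (rule ccontr)
    assume "G \<^bold>\<rightarrow> F \<notin> w"
    then have "{H. G \<^bold>\<rightarrow> H \<in> w} = w"
      using is_theory_conditional[OF th, of G] by (intro max) auto
    then show False using is_theory_conditional(3)[OF th, of G] that by blast
  qed
  have "\<^bold>\<bottom> \<notin> w" using is_theory_derivable_mp[OF th derivable_ex_falso] F by blast
  moreover have "G \<^bold>\<rightarrow> H \<in> w \<longleftrightarrow> (G \<in> w \<longrightarrow> H \<in> w)" for G H
  proof
    assume "G \<^bold>\<rightarrow> H \<in> w"
    then show "G \<in> w \<longrightarrow> H \<in> w" using is_theory_mp[OF th] by blast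
  next
    assume a: "G \<in> w \<longrightarrow> H \<in> w"
    show "G \<^bold>\<rightarrow> H \<in> w"
    proof (cases "G \<in> w")
      case True
      then show ?thesis using a is_theory_derivable_mp[OF th derivable_K] by blast
    next
      case False
      show ?thesis
      proof (rule ccontr)
        assume "G \<^bold>\<rightarrow> H \<notin> w"
        \<comment> \<open>With both G and G -> H outside \<open>w\<close>, \<open>imp\<close> gives
          G -> F and (G -> H) -> F in \<open>w\<close>, and the case distinction yields F.\<close>
        then have "F \<in> w"
          using is_theory_mp[OF th is_theory_derivable_mp[OF th derivable_cases]] imp False by blast
        with F show False ..
      qed
    qed
  qed
  ultimately show ?thesis using th F by (auto simp: maximal_theory_def is_theory_def)
qed

section \<open>The canonical model\<close>

lemma maximal_theory_axiom: "maximal_theory CS w \<Longrightarrow> JE_axiom A \<Longrightarrow> A \<in> w"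
  by (auto simp: maximal_theory_def intro: JE_derivable.ax)

lemma maximal_theory_derivable: "maximal_theory CS w \<Longrightarrow> CS \<turnstile>\<^sub>J\<^sub>E A \<Longrightarrow> A \<in> w"
  by (auto simp: maximal_theory_def)

lemma maximal_theory_Bot: "maximal_theory CS w \<Longrightarrow> \<^bold>\<bottom> \<notin> w"
  by (auto simp: maximal_theory_def)

lemma maximal_theory_Imp: "maximal_theory CS w \<Longrightarrow> F \<^bold>\<rightarrow> G \<in> w \<longleftrightarrow> (F \<in> w \<longrightarrow> G \<in> w)"
  by (auto simp: maximal_theory_def)

lemmas maximal_theory_simps = maximal_theory_Bot maximal_theory_Imp

lemma maximal_theory_je:
  assumes w: "maximal_theory CS w"
    and "l \<^bold>: (F \<^bold>\<rightarrow> G) \<in> w" "l \<^bold>: (G \<^bold>\<rightarrow> F) \<in> w" "\<^bold>[JE l\<^bold>] F \<in> w"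
  shows "\<^bold>[JE l\<^bold>] G \<in> w"
  using maximal_theory_axiom[OF w JE_axiom.je[of l F G]] assms(2-) maximal_theory_simps[OF w] by simp

lemma maximal_theory_jplus:
  assumes w: "maximal_theory CS w" and "l \<^bold>: F \<in> w \<or> k \<^bold>: F \<in> w"
  shows "(l \<^bold>+ k) \<^bold>: F \<in> w"
  using maximal_theory_axiom[OF w JE_axiom.jplus[of l F k]] assms(2) maximal_theory_simps[OF w] by auto

lemma maximal_theory_jeplus:
  assumes w: "maximal_theory CS w" and "\<^bold>[JE l\<^bold>] F \<in> w \<or> \<^bold>[JE k\<^bold>] F \<in> w"
  shows "\<^bold>[JE (l \<^bold>+ k)\<^bold>] F \<in> w"
  using maximal_theory_axiom[OF w JE_axiom.jeplus[of l F k]] assms(2) maximal_theory_simps[OF w] by auto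

text \<open>Neighbourhoods are described by membership of G, since \<open>truth_set\<close> would
  refer to the model being defined; the truth lemma later identifies the two.\<close>

definition canonical_model :: "'p const_spec \<Rightarrow> ('p, 'p fm set) model" where
  "canonical_model CS =
     \<lparr>worlds = {w. maximal_theory CS w},
      nbhd = (\<lambda>w. {{v. maximal_theory CS v \<and> G \<in> v} | G. \<exists>t. \<^bold>[t\<^bold>] G \<in> w}),
      eval_at = (\<lambda>w. \<lparr>val = (\<lambda>P. Atom P \<in> w), pev = (\<lambda>l. {F. l \<^bold>: F \<in> w}),
                      jev = (\<lambda>t. {F. \<^bold>[t\<^bold>] F \<in> w})\<rparr>)\<rparr>"

lemma canonical_model_sel:
  "worlds (canonical_model CS) = {w. maximal_theory CS w}"
  "nbhd (canonical_model CS) w = {{v. maximal_theory CS v \<and> G \<in> v} | G. \<exists>t. \<^bold>[t\<^bold>] G \<in> w}"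
  "val (eval_at (canonical_model CS) w) = (\<lambda>P. Atom P \<in> w)"
  "pev (eval_at (canonical_model CS) w) = (\<lambda>l. {F. l \<^bold>: F \<in> w})"
  "jev (eval_at (canonical_model CS) w) = (\<lambda>t. {F. \<^bold>[t\<^bold>] F \<in> w})"
  by (simp_all add: canonical_model_def)

text \<open>Atoms and both kinds of justified formulas are looked up in the evaluation, which is
  read off from \<open>w\<close>, so these cases hold by construction. Only \<bottom> and
  implication use the properties of a maximal theory.\<close>

lemma truth_lemma:
  "maximal_theory CS w \<Longrightarrow> holds (canonical_model CS) w F \<longleftrightarrow> F \<in> w"
  by (induction F) (simp_all add: canonical_model_sel maximal_theory_simps)

lemma truth_set_canonical_model:
  "truth_set (canonical_model CS) F = {v. maximal_theory CS v \<and> F \<in> v}"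
  by (auto simp: truth_set_def canonical_model_sel truth_lemma)

lemma basic_evaluation_canonical_model:
  assumes w: "maximal_theory CS w"
  shows "basic_evaluation CS (eval_at (canonical_model CS) w)"
proof -
  have "(l \<^bold>\<cdot> k) \<^bold>: F \<in> w" if "l \<^bold>: (G \<^bold>\<rightarrow> F) \<in> w" "k \<^bold>: G \<in> w" for l k F G
    using maximal_theory_axiom[OF w JE_axiom.j[of l G F k]] that maximal_theory_Imp[OF w] by simp
  moreover have "\<^bold>! l \<^bold>: l \<^bold>: F \<in> w" if "l \<^bold>: F \<in> w" for l F
    using maximal_theory_axiom[OF w JE_axiom.j4[of l F]] that maximal_theory_Imp[OF w] by simp
  moreover have "l \<^bold>: F \<in> w" if "(l, F) \<in> CS" for l F
    using that by (intro maximal_theory_derivable[OF w] JE_derivable.an)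
  ultimately show ?thesis
    using maximal_theory_jplus[OF w] maximal_theory_jeplus[OF w] maximal_theory_je[OF w]
    unfolding basic_evaluation_def canonical_model_sel set_app_def set_equiv_def by blast
qed

text \<open>The given \<open>w\<close> makes the set of worlds nonempty. Factivity is (jt) seen
  through the truth lemma, and the neighbourhoods were chosen to contain the required truth
  sets.\<close>

lemma modular_model_canonical_model:
  assumes "maximal_theory CS w"
  shows "modular_model CS (canonical_model CS)"
proof -
  have "F \<in> v" if v: "maximal_theory CS v" and "l \<^bold>: F \<in> v" for v l F
    using maximal_theory_axiom[OF v JE_axiom.jt[of l F]] that maximal_theory_Imp[OF v] by simp
  then have "factive (canonical_model CS)"
    by (auto simp: factive_def canonical_model_sel truth_lemma)
  moreover have "quasi_model CS (canonical_model CS)"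
    using assms basic_evaluation_canonical_model
    by (auto simp: quasi_model_def canonical_model_sel(1,2))
  ultimately show ?thesis
    by (auto simp: modular_model_def truth_set_canonical_model canonical_model_sel)
qed

text \<open>An underivable implication is missing from some maximal theory, which then contains F
  but not G.\<close>

lemma derivable_Imp_if_subset:
  assumes "\<And>v. maximal_theory CS v \<Longrightarrow> F \<in> v \<Longrightarrow> G \<in> v"
  shows "CS \<turnstile>\<^sub>J\<^sub>E F \<^bold>\<rightarrow> G"
  using assms lindenbaum[of CS "F \<^bold>\<rightarrow> G"] maximal_theory_Imp by blast

lemma fully_explanatory_canonical_model:
  assumes "axiomatically_appropriate CS"
  shows "fully_explanatory (canonical_model CS)"
proof -
  have "\<exists>t. \<^bold>[t\<^bold>] F \<in> w"
    if w: "maximal_theory CS w" and Gw: "\<^bold>[t\<^bold>] G \<in> w"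
      and eq: "{v. maximal_theory CS v \<and> F \<in> v} = {v. maximal_theory CS v \<and> G \<in> v}"
    for w t F G
  proof -
    obtain m where m: "\<^bold>[JE m\<^bold>] G \<in> w" using Gw by (cases t) auto
    have "CS \<turnstile>\<^sub>J\<^sub>E F \<^bold>\<rightarrow> G" "CS \<turnstile>\<^sub>J\<^sub>E G \<^bold>\<rightarrow> F"
      using eq by (auto intro!: derivable_Imp_if_subset)
    then obtain l k where "CS \<turnstile>\<^sub>J\<^sub>E l \<^bold>: (F \<^bold>\<rightarrow> G)" "CS \<turnstile>\<^sub>J\<^sub>E k \<^bold>: (G \<^bold>\<rightarrow> F)"
      using internalization[OF assms] by meson
    then have "l \<^bold>: (F \<^bold>\<rightarrow> G) \<in> w" "k \<^bold>: (G \<^bold>\<rightarrow> F) \<in> w"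
      using maximal_theory_derivable[OF w] by auto
    \<comment> \<open>The sum \<open>l + k\<close> justifies both implications at once. The summand
      \<open>m\<close> is added because (je) acts on the single term of the box, and
      \<open>m\<close> is the one that carries G.\<close>
    then have "(m \<^bold>+ (l \<^bold>+ k)) \<^bold>: (F \<^bold>\<rightarrow> G) \<in> w" "(m \<^bold>+ (l \<^bold>+ k)) \<^bold>: (G \<^bold>\<rightarrow> F) \<in> w"
      by (auto intro!: maximal_theory_jplus[OF w])
    moreover have "\<^bold>[JE (m \<^bold>+ (l \<^bold>+ k))\<^bold>] G \<in> w"
      using m by (auto intro!: maximal_theory_jeplus[OF w])
    ultimately show ?thesis using maximal_theory_je[OF w] by blast
  qed
  then show ?thesis
    by (auto simp: fully_explanatory_def truth_set_canonical_model canonical_model_sel)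
qed

theorem mainTheorem3:
  fixes CS :: "'p::countable const_spec" and F :: "'p fm"
  assumes "constant_specification CS" and "axiomatically_appropriate CS"
  shows "(CS \<turnstile>\<^sub>J\<^sub>E F \<longleftrightarrow>
            (\<forall>M :: ('p, 'p fm set) model. modular_model CS M \<and> fully_explanatory M \<longrightarrow> M \<TTurnstile> F)) \<and>
         (CS \<turnstile>\<^sub>J\<^sub>E F \<longrightarrow>
            (\<forall>M :: ('p, 'w) model. modular_model CS M \<and> fully_explanatory M \<longrightarrow> M \<TTurnstile> F))"
proof -
  have "CS \<turnstile>\<^sub>J\<^sub>E F"
    if valid: "\<forall>M :: ('p, 'p fm set) model. modular_model CS M \<and> fully_explanatory M \<longrightarrow> M \<TTurnstile> F"
  proof (rule ccontr)
    assume "\<not> CS \<turnstile>\<^sub>J\<^sub>E F"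
    then obtain w where w: "maximal_theory CS w" "F \<notin> w" using lindenbaum by blast
    have "canonical_model CS \<TTurnstile> F"
      using valid modular_model_canonical_model[OF w(1)]
        fully_explanatory_canonical_model[OF assms(2)] by blast
    then show False using w by (auto simp: valid_in_def canonical_model_sel(1) truth_lemma)
  qed
  \<comment> \<open>Soundness is instantiated twice: at sets of formulas, the world type of the
    canonical model, for the equivalence, and at the arbitrary type \<open>'w\<close> for the second
    conjunct.\<close>
  then show ?thesis
    using JE_sound[where 'b = "'p fm set", of CS F] JE_sound[where 'b = 'w, of CS F] by blast
qed

end
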